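(* Let $G = (V, E)$ be a finite regular undirected graph and let $\lambda = \lambda(G)$. Let $n \ge 1$, let $f_1, \ldots, f_n: V \rightarrow [0, 1]$, and let $\mu_i = \mathbb{E}[f_i(v)]$, where $v$ is uniformly distributed on $V$. Let $(Y_1, \ldots, Y_n)$ be the simple random walk on $G$ started at a uniformly random vertex, let $S_n = f_1(Y_1)+\cdots+f_n(Y_n)$, and let $\Phi := \mathbb{E}[S_n] = \mu_1 + \cdots + \mu_n$. Then for all real $t > 1/\lambda$, $$\Pr[S_n \geq t \Phi] \leq \left(\frac{1}{\lambda} - \frac{1-\lambda}{t^{1/2} \lambda^{3/2}}\right)^{-t \Phi} \exp\left(\Phi \cdot \frac{(1-\lambda)(\sqrt{t \lambda}-1)}{\lambda}\right).$$
   Context: For a finite $d$-regular undirected graph $G=(V,E)$ (self-loops are allowed; $d \ge 1$), the normalized adjacency matrix $A$ is the adjacency matrix divided by $d$, i.e. the transition matrix of the simple random walk. Let $J$ be the $|V|\times|V|$ matrix all of whose entries equal $1/|V|$, and define $\lambda(G) = \|A - J\|$, where $\|\cdot\|$ is the $\ell_2\to\ell_2$ operator norm. The simple random walk $(Y_1,\ldots,Y_n)$ of length $n$ on $G$: $Y_1$ is uniform on $V$, and each subsequent $Y_i$ is chosen uniformly from the neighbors of $Y_{i-1}$ (i.e. according to the transition matrix $A$). If $\lambda=0$, then $1/\lambda$ is read as $+\infty$, so that the statement is vacuous; thus only $\lambda>0$ matters. *)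

theory Defs
  imports "HOL-Probability.Probability"
begin

text \<open>
  The vertex set is the finite type \<open>'v\<close>. An undirected graph on it is a symmetric edge
  relation; loops are allowed, and a loop at \<open>v\<close> contributes one neighbour, namely \<open>v\<close> itself.
\<close>

definition neighbours :: "'v rel \<Rightarrow> 'v \<Rightarrow> 'v set" where
  "neighbours E v = E `` {v}"

definition regular_graph :: "('v::finite) rel \<Rightarrow> nat \<Rightarrow> bool" where
  "regular_graph E d \<longleftrightarrow> sym E \<and> d \<ge> 1 \<and> (\<forall>v. card (neighbours E v) = d)"

definition norm_adj :: "('v::finite) rel \<Rightarrow> nat \<Rightarrow> real ^ 'v ^ 'v" where
  "norm_adj E d = (\<chi> u v. (if (u, v) \<in> E then 1 else 0) / real d)"

definition averaging_matrix :: "real ^ ('v::finite) ^ 'v" where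
  "averaging_matrix = (\<chi> u v. 1 / real CARD('v))"

text \<open>The norm on \<open>real ^ 'v\<close> is the Euclidean one, so \<open>onorm\<close> is the operator norm on \<open>\<ell>\<^sub>2\<close>.\<close>

definition graph_lambda :: "('v::finite) rel \<Rightarrow> nat \<Rightarrow> real" where
  "graph_lambda E d = onorm ((*v) (norm_adj E d - averaging_matrix))"

text \<open>
  \<open>walk_from E p n\<close> is the joint law of the \<open>n\<close> successive vertices of the walk whose first vertex
  has law \<open>p\<close>; the list has length \<open>n\<close>, so its entry number \<open>i\<close> (from 0) is $Y_{i+1}$.
\<close>

primrec walk_from :: "('v::finite) rel \<Rightarrow> 'v pmf \<Rightarrow> nat \<Rightarrow> 'v list pmf" where
  "walk_from E p 0 = return_pmf []"
| "walk_from E p (Suc n) =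
     bind_pmf p (\<lambda>v. map_pmf (\<lambda>ys. v # ys) (walk_from E (pmf_of_set (neighbours E v)) n))"

definition random_walk :: "('v::finite) rel \<Rightarrow> nat \<Rightarrow> 'v list pmf" where
  "random_walk E n = walk_from E (pmf_of_set UNIV) n"

end

theory Submission imports Defs begin

text \<open>
  The tail bound is a Chernoff bound, so everything rests on the moment estimate
  $E[r^{S_n}] \le \exp(\Phi\,(r-1)(1-\lambda)/(1-\lambda r))$ for $1 < r < 1/\lambda$
  (\<open>moment_bound\<close>). The base of the power in the claim is the choice
  $r = 1/\lambda - (1-\lambda)/(t^{1/2}\lambda^{3/2})$. The exact minimiser of
  $r^{-t\Phi} \exp(\Phi\,(r-1)(1-\lambda)/(1-\lambda r))$ solves
  $t (1-\lambda r)^2 = (1-\lambda)^2 r$; this $r$ is what results when the last factor $r$ is replaced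
  by its upper limit $1/\lambda$. To see where the exponent comes from, take a walk that stays put
  with probability $\lambda$ and otherwise jumps to a uniform vertex, and count the visits to a small
  set: they come in about Poisson($\Phi(1-\lambda)$) many clusters, each of geometric length with
  parameter $\lambda$.

  For the moment estimate put $s = r - 1$. By convexity $r^x \le 1 + s x$ on $[0,1]$, so it is enough
  to bound $E[\prod_i (1 + s f_i(Y_i))]$. Conditioning on the first vertex turns this into the
  mean of the vector $h_1$, where $h_{n+1} = 1$ and $h_k = (1 + s f_k)\,A h_{k+1}$
  (\<open>expectation_walk_from_prod\<close>). Write $A = J + B$ with $\|B\| = \lambda$, so that
  $A h = G 1 + B h$ with $G$ the mean of $h$. Because $B$ kills constants and maps into the vectors
  of mean 0, the vector $B h_{k+1}$ affects the mean of $h_k$, and $G_{k+1} 1$ affects $B h_k$, only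
  through the part $s f_k$ of the multiplier $1 + s f_k$,
  and the pair consisting of $G_k$, the mean of $h_k$, and
  $b_k = \|B h_k\| / |V|^{1/2}$ satisfies, with $x_k = \mu_k^{1/2}$,
  \[ G_k \le (1 + s x_k^2)\,G_{k+1} + s x_k b_{k+1}, \qquad
     b_k \le \lambda\,(s x_k G_{k+1} + r b_{k+1}). \]

  Since $G_{k+1} \le G_k$, this gives $b_k \le s G_k T_k$ with $T_k = \lambda(x_k + r T_{k+1})$ and
  $T_{n+1} = 0$, so that $G_k \le (1 + s x_k^2 + s^2 x_k T_{k+1})\,G_{k+1}$, and what remains is the
  Hilbert-type inequality
  $\sum_k x_k T_{k+1} \le \frac{\lambda}{1-\lambda r} \sum_k x_k^2$. It follows by telescoping once
  the potential $T_k^2/(2\lambda)$ is carried along, because the defect of each step is then a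
  perfect square (\<open>potential_step\<close>). Both recursions are run in a single induction
  (\<open>twisted_walk_bound\<close>).
\<close>

section \<open>The normalized adjacency matrix\<close>

definition vmean :: "real ^ ('v::finite) \<Rightarrow> real" where
  "vmean x = (\<Sum>v\<in>UNIV. x $ v) / real CARD('v)"

lemma vmean_add: "vmean (x + y) = vmean x + vmean y"
  by (simp add: vmean_def sum.distrib add_divide_distrib)

lemma vmean_scaleR: "vmean (c *\<^sub>R x) = c * vmean x"
  by (simp add: vmean_def sum_distrib_left)

lemma vmean_one: "vmean 1 = 1"
  by (simp add: vmean_def)

lemma vmean_mono: "(\<And>v. x $ v \<le> y $ v) \<Longrightarrow> vmean x \<le> vmean y"
  unfolding vmean_def by (intro divide_right_mono sum_mono) auto

lemma vmean_mult_le_norm: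
  fixes x y :: "real ^ 'v::finite"
  shows "vmean (x * y) \<le> norm x * norm y / real CARD('v)"
proof -
  have "(\<Sum>v\<in>UNIV. (x * y) $ v) = x \<bullet> y"
    by (simp add: inner_vec_def)
  then show ?thesis
    unfolding vmean_def using norm_cauchy_schwarz[of x y] by (simp add: divide_right_mono)
qed

lemma norm_mult_vec_le:
  fixes x y :: "real ^ 'v::finite"
  assumes "\<And>v. \<bar>x $ v\<bar> \<le> c"
  shows "norm (x * y) \<le> c * norm y"
proof -
  have c: "0 \<le> c"
    using assms[of undefined] by linarith
  have "norm (x * y) \<le> norm (c *\<^sub>R y)"
    using assms c by (intro norm_le_componentwise_cart) (auto simp: abs_mult intro!: mult_right_mono)
  then show ?thesis
    using c by simp
qed

text \<open>For a function with values in $[0,1]$ the second moment is at most the first.\<close>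

lemma norm_le_sqrt_vmean:
  fixes x :: "real ^ 'v::finite"
  assumes "\<And>v. x $ v \<in> {0..1}"
  shows "norm x \<le> sqrt (vmean x) * sqrt (real CARD('v))"
proof -
  have "(\<Sum>v\<in>UNIV. (x $ v)\<^sup>2) \<le> (\<Sum>v\<in>UNIV. x $ v)"
    using assms by (intro sum_mono) (auto simp: power2_eq_square mult_left_le)
  then show ?thesis
    by (simp add: norm_vec_def L2_set_def vmean_def flip: real_sqrt_mult)
qed

lemma averaging_matrix_mult: "averaging_matrix *v x = vmean x *\<^sub>R 1"
  by (simp add: vec_eq_iff averaging_matrix_def matrix_vector_mult_def vmean_def
      flip: sum_divide_distrib)

lemma norm_adj_mult_nth:
  "(norm_adj E d *v x) $ v = (\<Sum>u\<in>neighbours E v. x $ u) / real d"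
proof -
  have "(norm_adj E d *v x) $ v = (\<Sum>u\<in>UNIV. if u \<in> neighbours E v then x $ u / real d else 0)"
    unfolding norm_adj_def matrix_vector_mult_def neighbours_def
    by (auto intro!: sum.cong)
  also have "\<dots> = (\<Sum>u\<in>neighbours E v. x $ u) / real d"
    by (subst sum.inter_filter[symmetric]) (auto simp: sum_divide_distrib)
  finally show ?thesis .
qed

text \<open>
  Double counting: summing over the neighbours of every vertex counts each vertex $d$ times,
  which is where symmetry of the edge relation enters.
\<close>

lemma sum_neighbours:
  fixes E :: "('v::finite) rel" and h :: "'v \<Rightarrow> real"
  assumes "regular_graph E d"
  shows "(\<Sum>v\<in>UNIV. \<Sum>u\<in>neighbours E v. h u) = real d * (\<Sum>v\<in>UNIV. h v)"
proof -
  have sym: "v \<in> neighbours E u \<longleftrightarrow> u \<in> neighbours E v" for u v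
    using assms by (auto simp: regular_graph_def neighbours_def sym_def)
  have "(\<Sum>v\<in>UNIV. \<Sum>u\<in>neighbours E v. h u)
      = (\<Sum>v\<in>UNIV. \<Sum>u\<in>UNIV. if u \<in> neighbours E v then h u else 0)"
    by (simp add: sum.If_cases)
  also have "\<dots> = (\<Sum>u\<in>UNIV. \<Sum>v\<in>UNIV. if v \<in> neighbours E u then h u else 0)"
    by (subst sum.swap) (simp add: sym)
  also have "\<dots> = (\<Sum>u\<in>UNIV. real (card (neighbours E u)) * h u)"
    by (simp add: sum.If_cases)
  also have "\<dots> = real d * (\<Sum>v\<in>UNIV. h v)"
    using assms by (simp add: regular_graph_def sum_distrib_left)
  finally show ?thesis .
qed

lemma vmean_norm_adj:
  assumes "regular_graph E d"
  shows "vmean (norm_adj E d *v x) = vmean x"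
proof -
  have "real d \<noteq> 0"
    using assms by (simp add: regular_graph_def)
  then show ?thesis
    using sum_neighbours[OF assms, of "\<lambda>u. x $ u"]
    by (simp add: vmean_def norm_adj_mult_nth flip: sum_divide_distrib)
qed

lemma norm_adj_one: "regular_graph E d \<Longrightarrow> norm_adj E d *v 1 = 1"
  by (simp add: vec_eq_iff norm_adj_mult_nth regular_graph_def)

lemma norm_adj_nonneg:
  assumes "\<And>v. 0 \<le> x $ v"
  shows "0 \<le> (norm_adj E d *v x) $ v"
  using assms by (simp add: norm_adj_mult_nth sum_nonneg)

text \<open>By Cauchy--Schwarz, averaging over neighbours does not increase the Euclidean norm.\<close>

lemma norm_norm_adj_le:
  fixes E :: "('v::finite) rel"
  assumes "regular_graph E d"
  shows "norm (norm_adj E d *v x) \<le> norm x"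
proof -
  have d: "real d > 0" and card: "card (neighbours E v) = d" for v
    using assms by (simp_all add: regular_graph_def)
  have "((norm_adj E d *v x) $ v)\<^sup>2 \<le> (\<Sum>u\<in>neighbours E v. (x $ u)\<^sup>2) / real d" for v
    using sum_squared_le_sum_of_squares[of "\<lambda>u. x $ u" "neighbours E v"] d
    by (simp add: norm_adj_mult_nth card power_divide divide_simps power2_eq_square)
  then have "(\<Sum>v\<in>UNIV. ((norm_adj E d *v x) $ v)\<^sup>2)
      \<le> (\<Sum>v\<in>UNIV. (\<Sum>u\<in>neighbours E v. (x $ u)\<^sup>2) / real d)"
    by (rule sum_mono)
  also have "\<dots> = (\<Sum>v\<in>UNIV. (x $ v)\<^sup>2)"
    using sum_neighbours[OF assms, of "\<lambda>u. (x $ u)\<^sup>2"] d by (simp flip: sum_divide_distrib)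
  finally show ?thesis
    by (simp add: norm_vec_def L2_set_def)
qed

lemma norm_centred_le:
  fixes x :: "real ^ 'v::finite"
  shows "norm (x - vmean x *\<^sub>R 1) \<le> norm x"
proof -
  have "(1 :: real ^ 'v) \<bullet> x = real CARD('v) * vmean x" "(1 :: real ^ 'v) \<bullet> 1 = real CARD('v)"
    by (simp_all add: inner_vec_def vmean_def)
  then have "(norm (x - vmean x *\<^sub>R 1))\<^sup>2 = (norm x)\<^sup>2 - real CARD('v) * (vmean x)\<^sup>2"
    unfolding power2_norm_eq_inner
    by (simp add: inner_diff_left inner_diff_right inner_commute power2_eq_square algebra_simps)
  then have "(norm (x - vmean x *\<^sub>R 1))\<^sup>2 \<le> (norm x)\<^sup>2"
    by simp
  then show ?thesis
    by (rule power2_le_imp_le) simp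
qed

section \<open>The deviation from averaging\<close>

definition deviation :: "('v::finite) rel \<Rightarrow> nat \<Rightarrow> real ^ 'v \<Rightarrow> real ^ 'v" where
  "deviation E d x = (norm_adj E d - averaging_matrix) *v x"

lemma norm_adj_split: "norm_adj E d *v x = vmean x *\<^sub>R 1 + deviation E d x"
  by (simp add: deviation_def matrix_vector_mult_diff_rdistrib averaging_matrix_mult)

lemma deviation_add: "deviation E d (x + y) = deviation E d x + deviation E d y"
  by (simp add: deviation_def matrix_vector_right_distrib)

lemma deviation_scaleR: "deviation E d (c *\<^sub>R x) = c *\<^sub>R deviation E d x"
  by (simp add: deviation_def matrix_vector_mult_scaleR)

lemma deviation_one: "regular_graph E d \<Longrightarrow> deviation E d 1 = 0"
  using norm_adj_split[of E d 1] by (simp add: norm_adj_one vmean_one)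

lemma vmean_deviation: "regular_graph E d \<Longrightarrow> vmean (deviation E d x) = 0"
  using arg_cong[OF norm_adj_split[of E d x], of vmean]
  by (simp add: vmean_norm_adj vmean_add vmean_scaleR vmean_one)

lemma norm_deviation_le: "norm (deviation E d x) \<le> graph_lambda E d * norm x"
  unfolding deviation_def graph_lambda_def by (rule onorm) simp

text \<open>
  Because $A$ fixes constants, $A - J$ is $A$ applied after subtracting the mean, a composition of
  two contractions.
\<close>

lemma graph_lambda_le_one:
  assumes "regular_graph E d"
  shows "graph_lambda E d \<le> 1"
  unfolding graph_lambda_def
proof (rule onorm_le)
  fix x :: "real ^ 'a"
  have "(norm_adj E d - averaging_matrix) *v x = norm_adj E d *v (x - vmean x *\<^sub>R 1)"
    by (simp add: matrix_vector_mult_diff_rdistrib matrix_vector_mult_diff_distrib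
        averaging_matrix_mult matrix_vector_mult_scaleR norm_adj_one[OF assms])
  then show "norm ((norm_adj E d - averaging_matrix) *v x) \<le> 1 * norm x"
    using norm_norm_adj_le[OF assms, of "x - vmean x *\<^sub>R 1"] norm_centred_le[of x] by simp
qed

section \<open>The moment recursion\<close>

text \<open>
  Entry \<open>v\<close> is the conditional expectation of $\prod_{i<n} g_i(Y_{i+1})$ given $Y_1 = v$; the
  product of vectors is taken entrywise.
\<close>

primrec twisted_walk :: "('v::finite) rel \<Rightarrow> nat \<Rightarrow> (nat \<Rightarrow> real ^ 'v) \<Rightarrow> nat \<Rightarrow> real ^ 'v" where
  "twisted_walk E d g 0 = 1"
| "twisted_walk E d g (Suc n) = g 0 * (norm_adj E d *v twisted_walk E d (\<lambda>i. g (Suc i)) n)"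

lemma twisted_walk_nonneg:
  assumes "\<And>i v. i < n \<Longrightarrow> 0 \<le> g i $ v"
  shows "0 \<le> twisted_walk E d g n $ v"
  using assms
proof (induction n arbitrary: g v)
  case (Suc n)
  have "0 \<le> twisted_walk E d (\<lambda>i. g (Suc i)) n $ u" for u
    using Suc.prems by (intro Suc.IH) auto
  then show ?case
    using Suc.prems[of 0] by (simp add: norm_adj_nonneg)
qed simp

text \<open>
  One step of the Hilbert-type inequality. The weight $1/(2\lambda)$ of the potential makes the
  quadratic form $\frac{\lambda}{1-\lambda r}x^2 - xT - \frac{\lambda}{2}(x + rT)^2 +
  \frac{1}{2\lambda}T^2$ degenerate, hence a multiple of a square.
\<close>

lemma potential_step:
  fixes lam r x T :: real
  assumes "0 < lam" "0 < r" "lam * r < 1"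
  shows "x * T + (lam * (x + r * T))\<^sup>2 / (2 * lam)
    \<le> lam / (1 - lam * r) * x\<^sup>2 + T\<^sup>2 / (2 * lam)"
proof -
  have "lam / (1 - lam * r) * x\<^sup>2 + T\<^sup>2 / (2 * lam) - (x * T + (lam * (x + r * T))\<^sup>2 / (2 * lam))
      = (1 + lam * r) / (2 * lam * (1 - lam * r)) * (lam * x - (1 - lam * r) * T)\<^sup>2"
    using assms by (simp add: field_simps power2_eq_square)
  also have "\<dots> \<ge> 0"
    using assms by (intro mult_nonneg_nonneg divide_nonneg_nonneg) auto
  finally show ?thesis
    by simp
qed

text \<open>
  The mean of \<open>h\<close> can only be propagated backwards together with the part of \<open>h\<close> that one more
  step of the walk does not average out. The number \<open>T\<close> measures that part relative to the mean, and
  the term $-T^2/(2\lambda)$ in the exponent is the credit that pays for its effect on the mean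
  one step further.
\<close>

lemma twisted_walk_bound:
  fixes E :: "('v::finite) rel" and d :: nat and f :: "nat \<Rightarrow> real ^ 'v"
  defines "lam \<equiv> graph_lambda E d"
  assumes reg: "regular_graph E d"
    and lam: "0 < lam" and r: "1 < r" "lam * r < 1"
    and f: "\<And>i v. i < n \<Longrightarrow> f i $ v \<in> {0..1}"
  defines "h \<equiv> twisted_walk E d (\<lambda>i. 1 + (r - 1) *\<^sub>R f i) n"
  shows "\<exists>T\<ge>0. norm (deviation E d h) \<le> (r - 1) * vmean h * T * sqrt (real CARD('v)) \<and>
    vmean h \<le> exp ((r - 1) * (\<Sum>i<n. vmean (f i))
      + (r - 1)\<^sup>2 * (lam / (1 - lam * r) * (\<Sum>i<n. vmean (f i)) - T\<^sup>2 / (2 * lam)))"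
  using f unfolding h_def
proof (induction n arbitrary: f)
  case 0
  show ?case
    by (intro exI[of _ 0]) (simp add: deviation_one[OF reg] vmean_one)
next
  case (Suc n)
  define s where "s = r - 1"
  define N where "N = sqrt (real CARD('v))"
  define B where "B = deviation E d"
  define F where "F = f 0"
  define x where "x = sqrt (vmean F)"
  define h' where "h' = twisted_walk E d (\<lambda>i. 1 + s *\<^sub>R f (Suc i)) n"
  define D where "D = 1 + s *\<^sub>R F"
  define h where "h = D * (norm_adj E d *v h')"
  define \<Phi> where "\<Phi> = (\<Sum>i<n. vmean (f (Suc i)))"
  define c where "c = lam / (1 - lam * r)"
  have s: "s > 0" and N: "N > 0" "N * N = real CARD('v)"
    using r by (auto simp: s_def N_def)
  have F: "F $ v \<in> {0..1}" for v
    using Suc.prems[of 0] by (simp add: F_def)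
  have D: "1 \<le> D $ v" "\<bar>D $ v\<bar> \<le> r" for v
  proof -
    have "0 \<le> s * F $ v" "s * F $ v \<le> s"
      using F[of v] s by (auto simp: mult_left_le)
    then show "1 \<le> D $ v" "\<bar>D $ v\<bar> \<le> r"
      by (auto simp: D_def s_def)
  qed
  have x: "0 \<le> x" "x\<^sup>2 = vmean F"
    using F vmean_mono[of 0 F] by (auto simp: x_def vmean_def sum_nonneg)
  have nF: "norm F \<le> x * N"
    unfolding x_def N_def by (rule norm_le_sqrt_vmean) (rule F)
  have f': "f (Suc i) $ v \<in> {0..1}" if "i < n" for i v
    using Suc.prems that by simp
  have h'_nonneg: "0 \<le> h' $ v" for v
    unfolding h'_def
    using s by (intro twisted_walk_nonneg) (use f' in \<open>auto intro!: add_nonneg_nonneg\<close>)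
  from Suc.IH[of "\<lambda>i. f (Suc i)", OF f'] obtain T where T: "0 \<le> T"
    and b': "norm (B h') \<le> s * vmean h' * T * N"
    and G': "vmean h' \<le> exp (s * \<Phi> + s\<^sup>2 * (c * \<Phi> - T\<^sup>2 / (2 * lam)))"
    by (auto simp: h'_def s_def N_def B_def \<Phi>_def c_def)
  have G'_nonneg: "0 \<le> vmean h'"
    using h'_nonneg by (simp add: vmean_def sum_nonneg)
  have split: "h = vmean h' *\<^sub>R (1 + s *\<^sub>R F) + (B h' + s *\<^sub>R (F * B h'))"
    "h = vmean h' *\<^sub>R (1 + s *\<^sub>R F) + D * B h'"
    by (simp_all add: vec_eq_iff h_def D_def B_def norm_adj_split algebra_simps)
  have G_mono: "vmean h' \<le> vmean h"
  proof -
    have "vmean (norm_adj E d *v h') \<le> vmean h"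
      using mult_right_mono[OF D(1) norm_adj_nonneg[OF h'_nonneg, of E d]]
      by (intro vmean_mono) (simp add: h_def)
    then show ?thesis
      by (simp add: vmean_norm_adj[OF reg])
  qed
  have "vmean h = vmean h' * (1 + s * x\<^sup>2) + s * vmean (F * B h')"
    \<comment> \<open>\<open>B h'\<close> itself has mean 0, so that it enters only through \<open>F * B h'\<close>.\<close>
    unfolding split(1) using vmean_deviation[OF reg]
    by (simp add: vmean_add vmean_scaleR vmean_one x B_def)
  also have "vmean (F * B h') \<le> vmean h' * (s * x * T)"
  proof -
    have "vmean (F * B h') \<le> norm F * norm (B h') / (N * N)"
      unfolding N(2) by (rule vmean_mult_le_norm)
    also have "norm F * norm (B h') \<le> (x * N) * (s * vmean h' * T * N)"
      using nF b' x N by (intro mult_mono) auto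
    finally show ?thesis
      using N(1) by (simp add: field_simps)
  qed
  finally have "vmean h \<le> vmean h' * (1 + (s * x\<^sup>2 + s\<^sup>2 * (x * T)))"
    using s by (simp add: algebra_simps power2_eq_square)
  also have "\<dots> \<le> vmean h' * exp (s * x\<^sup>2 + s\<^sup>2 * (x * T))"
    by (intro mult_left_mono G'_nonneg exp_ge_add_one_self)
  also have "\<dots> \<le> exp (s * \<Phi> + s\<^sup>2 * (c * \<Phi> - T\<^sup>2 / (2 * lam))) * exp (s * x\<^sup>2 + s\<^sup>2 * (x * T))"
    using G' by (intro mult_right_mono) auto
  also have "\<dots> = exp (s * (x\<^sup>2 + \<Phi>) + s\<^sup>2 * (c * \<Phi> + (x * T - T\<^sup>2 / (2 * lam))))"
    by (simp add: algebra_simps flip: exp_add)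
  also have "\<dots> \<le> exp (s * (x\<^sup>2 + \<Phi>)
      + s\<^sup>2 * (c * \<Phi> + (c * x\<^sup>2 - (lam * (x + r * T))\<^sup>2 / (2 * lam))))"
    using potential_step[of lam r x T] lam r
    by (simp add: c_def mult_left_mono)
  finally have G: "vmean h \<le> exp (s * (x\<^sup>2 + \<Phi>)
      + s\<^sup>2 * (c * (x\<^sup>2 + \<Phi>) - (lam * (x + r * T))\<^sup>2 / (2 * lam)))"
    by (simp add: algebra_simps)
  have "B h = B ((vmean h' * s) *\<^sub>R F) + B (D * B h')"
    unfolding split(2)
    by (simp add: B_def deviation_add scaleR_add_right deviation_scaleR deviation_one[OF reg])
  then have "norm (B h) \<le> norm (B ((vmean h' * s) *\<^sub>R F)) + norm (B (D * B h'))"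
    using norm_triangle_ineq by simp
  also have "\<dots> \<le> lam * (vmean h' * s * (x * N)) + lam * (r * (s * vmean h' * T * N))"
  proof (rule add_mono)
    have "norm (B ((vmean h' * s) *\<^sub>R F)) \<le> lam * norm ((vmean h' * s) *\<^sub>R F)"
      unfolding B_def lam_def by (rule norm_deviation_le)
    also have "\<dots> \<le> lam * (vmean h' * s * (x * N))"
      using nF s lam G'_nonneg by (simp add: mult_left_mono)
    finally show "norm (B ((vmean h' * s) *\<^sub>R F)) \<le> lam * (vmean h' * s * (x * N))" .
    have "norm (B (D * B h')) \<le> lam * norm (D * B h')"
      unfolding B_def lam_def by (rule norm_deviation_le)
    also have "\<dots> \<le> lam * (r * norm (B h'))"
      using D(2) lam by (intro mult_left_mono norm_mult_vec_le) auto
    also have "\<dots> \<le> lam * (r * (s * vmean h' * T * N))"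
      using b' lam r by (intro mult_left_mono) auto
    finally show "norm (B (D * B h')) \<le> lam * (r * (s * vmean h' * T * N))" .
  qed
  also have "\<dots> = s * vmean h' * (lam * (x + r * T)) * N"
    by (simp add: algebra_simps)
  also have "\<dots> \<le> s * vmean h * (lam * (x + r * T)) * N"
    using G_mono s lam x T r N by (intro mult_right_mono mult_left_mono) auto
  finally have b: "norm (B h) \<le> s * vmean h * (lam * (x + r * T)) * N" .
  have sum: "(\<Sum>i<Suc n. vmean (f i)) = x\<^sup>2 + \<Phi>"
    unfolding sum.lessThan_Suc_shift by (simp add: x \<Phi>_def F_def)
  have tw: "twisted_walk E d (\<lambda>i. 1 + (r - 1) *\<^sub>R f i) (Suc n) = h"
    by (simp add: h_def D_def h'_def s_def F_def)
  show ?case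
    unfolding tw sum
    using b G lam x T r by (intro exI[of _ "lam * (x + r * T)"]) (simp add: B_def s_def N_def c_def)
qed

lemma vmean_twisted_walk_le:
  fixes E :: "('v::finite) rel" and d :: nat and f :: "nat \<Rightarrow> real ^ 'v"
  defines "lam \<equiv> graph_lambda E d"
  assumes "regular_graph E d" and lam: "0 < lam" and r: "1 < r" "lam * r < 1"
    and "\<And>i v. i < n \<Longrightarrow> f i $ v \<in> {0..1}"
  shows "vmean (twisted_walk E d (\<lambda>i. 1 + (r - 1) *\<^sub>R f i) n)
    \<le> exp ((\<Sum>i<n. vmean (f i)) * ((1 - lam) * (r - 1) / (1 - lam * r)))"
proof -
  define \<Phi> where "\<Phi> = (\<Sum>i<n. vmean (f i))"
  from twisted_walk_bound[of E d r n f] assms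
  obtain T where "vmean (twisted_walk E d (\<lambda>i. 1 + (r - 1) *\<^sub>R f i) n)
      \<le> exp ((r - 1) * \<Phi> + (r - 1)\<^sup>2 * (lam / (1 - lam * r) * \<Phi> - T\<^sup>2 / (2 * lam)))"
    by (auto simp: \<Phi>_def)
  also have "\<dots> \<le> exp ((r - 1) * \<Phi> + (r - 1)\<^sup>2 * (lam / (1 - lam * r) * \<Phi>))"
    using lam by (intro iffD2[OF exp_le_cancel_iff] add_left_mono mult_left_mono) auto
  also have "(r - 1) * \<Phi> + (r - 1)\<^sup>2 * (lam / (1 - lam * r) * \<Phi>)
      = \<Phi> * ((1 - lam) * (r - 1) / (1 - lam * r))"
    using r by (simp add: field_simps power2_eq_square)
  finally show ?thesis
    by (simp add: \<Phi>_def)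
qed

section \<open>The random walk\<close>

lemma finite_set_walk_from: "finite (set_pmf (walk_from E p n))"
  by (induction n arbitrary: p) auto

lemma expectation_walk_from_prod:
  fixes E :: "('v::finite) rel"
  assumes reg: "regular_graph E d"
  shows "measure_pmf.expectation (walk_from E p n) (\<lambda>ys. \<Prod>i<n. g i $ (ys ! i))
    = measure_pmf.expectation p (\<lambda>v. twisted_walk E d g n $ v)"
proof (induction n arbitrary: g p)
  case 0
  have "(\<lambda>v. (1 :: real ^ 'v) $ v) = (\<lambda>v. 1)"
    by (rule ext) simp
  then show ?case
    by simp
next
  case (Suc n)
  have nbr: "card (neighbours E v) = d" "neighbours E v \<noteq> {}" for v
  proof -
    show "card (neighbours E v) = d"
      using reg by (simp add: regular_graph_def)
    moreover have "d \<ge> 1"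
      using reg by (simp add: regular_graph_def)
    ultimately show "neighbours E v \<noteq> {}"
      by auto
  qed
  have "measure_pmf.expectation (walk_from E p (Suc n)) (\<lambda>ys. \<Prod>i<Suc n. g i $ (ys ! i))
      = (\<Sum>v\<in>UNIV. pmf p v * (g 0 $ v *
          measure_pmf.expectation (walk_from E (pmf_of_set (neighbours E v)) n)
            (\<lambda>ys. \<Prod>i<n. g (Suc i) $ (ys ! i))))"
    unfolding walk_from.simps prod.lessThan_Suc_shift
    by (subst pmf_expectation_bind[of UNIV]) (simp_all add: finite_set_walk_from)
  also have "\<dots> = (\<Sum>v\<in>UNIV. pmf p v * twisted_walk E d g (Suc n) $ v)"
    unfolding Suc.IH by (simp add: integral_pmf_of_set nbr norm_adj_mult_nth)
  also have "\<dots> = measure_pmf.expectation p (\<lambda>v. twisted_walk E d g (Suc n) $ v)"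
    by (subst integral_measure_pmf[of UNIV]) auto
  finally show ?case .
qed

lemma expectation_random_walk_prod:
  fixes E :: "('v::finite) rel"
  assumes "regular_graph E d"
  shows "measure_pmf.expectation (random_walk E n) (\<lambda>ys. \<Prod>i<n. g i $ (ys ! i))
    = vmean (twisted_walk E d g n)"
  unfolding random_walk_def expectation_walk_from_prod[OF assms]
  by (simp add: integral_pmf_of_set vmean_def)

text \<open>
  The uniform distribution is stationary: in the product formula with all factors but one equal
  to 1, the factors after position $j$ disappear since $A$ fixes constants, and those before it
  since $A$ preserves the mean.
\<close>

lemma expectation_random_walk_nth:
  fixes E :: "('v::finite) rel"
  assumes reg: "regular_graph E d" and "j < n"
  shows "measure_pmf.expectation (random_walk E n) (\<lambda>ys. x $ (ys ! j)) = vmean x"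
proof -
  have ones: "twisted_walk E d (\<lambda>i. 1) n = 1" for n
    by (induction n) (simp_all add: norm_adj_one[OF reg])
  have "vmean (twisted_walk E d (\<lambda>i. if i = j then x else 1) n) = vmean x"
    using \<open>j < n\<close>
  proof (induction n arbitrary: j)
    case (Suc n)
    then show ?case
      by (cases j) (simp_all add: ones norm_adj_one[OF reg] vmean_norm_adj[OF reg])
  qed simp
  moreover have "(\<Prod>i<n. (if i = j then x else 1) $ (ys ! i)) = x $ (ys ! j)" for ys
  proof -
    have "(\<Prod>i<n. (if i = j then x else 1) $ (ys ! i)) = (\<Prod>i<n. if i = j then x $ (ys ! j) else 1)"
      by (rule prod.cong) auto
    then show ?thesis
      using \<open>j < n\<close> by simp
  qed
  ultimately show ?thesis
    using expectation_random_walk_prod[OF reg, of n "\<lambda>i. if i = j then x else 1"] by simp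
qed

lemma exp_ln_mult_le:
  fixes r x :: real
  assumes "0 < r" "x \<in> {0..1}"
  shows "exp (ln r * x) \<le> 1 + (r - 1) * x"
  using convex_onD[OF exp_convex, of x 0 "ln r"] assms by (simp add: algebra_simps)

lemma moment_bound:
  fixes E :: "('v::finite) rel" and d :: nat and f :: "nat \<Rightarrow> real ^ 'v"
  defines "lam \<equiv> graph_lambda E d"
  assumes reg: "regular_graph E d" and "0 < lam" and r: "1 < r" "lam * r < 1"
    and f: "\<And>i v. i < n \<Longrightarrow> f i $ v \<in> {0..1}"
  shows "measure_pmf.expectation (random_walk E n) (\<lambda>ys. exp (ln r * (\<Sum>i<n. f i $ (ys ! i))))
    \<le> exp ((\<Sum>i<n. vmean (f i)) * ((1 - lam) * (r - 1) / (1 - lam * r)))"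
proof -
  have int: "integrable (measure_pmf (random_walk E n)) g" for g :: "'v list \<Rightarrow> real"
    unfolding random_walk_def by (intro integrable_measure_pmf_finite finite_set_walk_from)
  have "exp (ln r * (\<Sum>i<n. f i $ (ys ! i))) \<le> (\<Prod>i<n. (1 + (r - 1) *\<^sub>R f i) $ (ys ! i))" for ys
  proof -
    have "exp (ln r * (\<Sum>i<n. f i $ (ys ! i))) = (\<Prod>i<n. exp (ln r * f i $ (ys ! i)))"
      by (simp add: exp_sum sum_distrib_left)
    also have "\<dots> \<le> (\<Prod>i<n. (1 + (r - 1) *\<^sub>R f i) $ (ys ! i))"
      using r f by (intro prod_mono) (auto intro!: exp_ln_mult_le)
    finally show ?thesis .
  qed
  then have "measure_pmf.expectation (random_walk E n) (\<lambda>ys. exp (ln r * (\<Sum>i<n. f i $ (ys ! i))))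
      \<le> measure_pmf.expectation (random_walk E n)
          (\<lambda>ys. \<Prod>i<n. (1 + (r - 1) *\<^sub>R f i) $ (ys ! i))"
    by (intro integral_mono int)
  also have "\<dots> = vmean (twisted_walk E d (\<lambda>i. 1 + (r - 1) *\<^sub>R f i) n)"
    by (rule expectation_random_walk_prod[OF reg])
  also have "\<dots> \<le> exp ((\<Sum>i<n. vmean (f i)) * ((1 - lam) * (r - 1) / (1 - lam * r)))"
    using assms vmean_twisted_walk_le[of E d r n f] by (simp add: lam_def)
  finally show ?thesis .
qed

section \<open>The tail bound\<close>

text \<open>
  With $z = (t\lambda)^{1/2}$ the base is $r = (1 - (1-\lambda)/z)/\lambda$, so that
  $1 - \lambda r = (1-\lambda)/z$ and $r - 1 = (1-\lambda)(1-1/z)/\lambda$.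
\<close>

lemma optimal_base:
  fixes lam t :: real
  assumes "0 < lam" "lam < 1" "t > 1 / lam"
  defines "r \<equiv> 1 / lam - (1 - lam) / (t powr (1/2) * lam powr (3/2))"
  shows "1 < r" "lam * r < 1"
    and "(1 - lam) * (r - 1) / (1 - lam * r) = (1 - lam) * (sqrt (t * lam) - 1) / lam"
proof -
  define z where "z = sqrt (t * lam)"
  have "t * lam > 1"
    using assms by (simp add: field_simps)
  then have z: "z > 1"
    by (simp add: z_def)
  have t: "t > 0"
    using assms(1,3) by (meson less_trans zero_less_divide_1_iff)
  have "lam powr (3/2) = lam powr (1 + 1/2)"
    by simp
  also have "\<dots> = lam * sqrt lam"
    using assms(1) by (subst powr_add) (simp add: powr_half_sqrt)
  finally have "t powr (1/2) * lam powr (3/2) = z * lam"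
    using t assms(1) by (simp add: z_def powr_half_sqrt real_sqrt_mult)
  then have r: "r = 1 / lam - (1 - lam) / (z * lam)"
    by (simp add: r_def)
  have 1: "r - 1 = (1 - lam) * (z - 1) / (z * lam)"
    using z assms(1) by (simp add: r field_simps)
  have 2: "1 - lam * r = (1 - lam) / z"
    using z assms(1) by (simp add: r field_simps)
  have "0 < r - 1" "0 < 1 - lam * r"
    unfolding 1 2 using z assms(1,2) by auto
  then show "1 < r" "lam * r < 1"
    by auto
  show "(1 - lam) * (r - 1) / (1 - lam * r) = (1 - lam) * (sqrt (t * lam) - 1) / lam"
    unfolding 1 2 z_def[symmetric] using z assms(1,2) by (simp add: field_simps)
qed

theorem corollary1p2:
  fixes E :: "('v::finite) rel" and d n :: nat
    and f :: "nat \<Rightarrow> 'v \<Rightarrow> real" and \<mu> :: "nat \<Rightarrow> real"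
    and S :: "'v list \<Rightarrow> real" and lam \<Phi> :: real
  assumes "regular_graph E d"
    and "lam = graph_lambda E d"
    and "n \<ge> 1"
    and "\<forall>i<n. \<forall>v. f i v \<in> {0..1}"
    and "\<forall>i<n. \<mu> i = measure_pmf.expectation (pmf_of_set UNIV) (f i)"
    and "\<forall>ys. S ys = (\<Sum>i<n. f i (ys ! i))"
    and "\<Phi> = measure_pmf.expectation (random_walk E n) S"
  shows "\<Phi> = (\<Sum>i<n. \<mu> i) \<and>
    (lam > 0 \<longrightarrow> (\<forall>t > 1 / lam.
       measure_pmf.prob (random_walk E n) {ys. S ys \<ge> t * \<Phi>}
         \<le> (1 / lam - (1 - lam) / (t powr (1/2) * lam powr (3/2))) powr (- (t * \<Phi>))
            * exp (\<Phi> * ((1 - lam) * (sqrt (t * lam) - 1) / lam))))"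
proof (intro conjI impI allI)
  define F :: "nat \<Rightarrow> real ^ 'v" where "F i = (\<chi> v. f i v)" for i
  have S: "S = (\<lambda>ys. \<Sum>i<n. F i $ (ys ! i))"
    using assms(6) by (auto simp: F_def)
  have F: "F i $ v \<in> {0..1}" if "i < n" for i v
    using assms(4) that by (simp add: F_def)
  have int: "integrable (measure_pmf (random_walk E n)) g" for g :: "'v list \<Rightarrow> real"
    unfolding random_walk_def by (intro integrable_measure_pmf_finite finite_set_walk_from)
  have mean: "\<Phi> = (\<Sum>i<n. vmean (F i))"
    unfolding assms(7) S using int by (simp add: expectation_random_walk_nth[OF assms(1)])
  also have "\<dots> = (\<Sum>i<n. \<mu> i)"
    using assms(5) by (intro sum.cong) (simp_all add: integral_pmf_of_set vmean_def F_def)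
  finally show "\<Phi> = (\<Sum>i<n. \<mu> i)" .

  fix t
  assume lam: "lam > 0" and t: "t > 1 / lam"
  define r where "r = 1 / lam - (1 - lam) / (t powr (1/2) * lam powr (3/2))"
  show "measure_pmf.prob (random_walk E n) {ys. S ys \<ge> t * \<Phi>}
      \<le> (1 / lam - (1 - lam) / (t powr (1/2) * lam powr (3/2))) powr (- (t * \<Phi>))
         * exp (\<Phi> * ((1 - lam) * (sqrt (t * lam) - 1) / lam))"
  proof (cases "lam = 1")
    \<comment> \<open>Here the base is 1 and the exponential is 1, so the bound is trivial.\<close>
    case True
    then show ?thesis
      by simp
  next
    case False
    then have "lam < 1"
      using graph_lambda_le_one[OF assms(1)] assms(2) by simp
    note base = optimal_base[OF lam this t, folded r_def]
    have "measure_pmf.prob (random_walk E n) {ys \<in> UNIV. S ys \<ge> t * \<Phi>}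
        \<le> exp (- ln r * (t * \<Phi>)) * (\<integral>ys\<in>UNIV. exp (ln r * S ys) \<partial>measure_pmf (random_walk E n))"
      using base(1) int by (intro measure_pmf.Chernoff_ineq_ge) (auto simp: set_integrable_def)
    also have "(\<integral>ys\<in>UNIV. exp (ln r * S ys) \<partial>measure_pmf (random_walk E n))
        \<le> exp (\<Phi> * ((1 - lam) * (r - 1) / (1 - lam * r)))"
      unfolding mean S assms(2)
      using moment_bound[OF assms(1) lam[unfolded assms(2)] base(1) base(2)[unfolded assms(2)] F]
      by (simp add: set_lebesgue_integral_def)
    also have "exp (- ln r * (t * \<Phi>)) = r powr (- (t * \<Phi>))"
      using base(1) by (simp add: powr_def)
    finally show ?thesis
      unfolding base(3) by (simp add: r_def)
  qed
qed

end
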